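(* Let $D$ be a division ring with infinite center $F$, let $n$ be a positive integer, and let $p\in F[x]$ be a nonconstant polynomial. Suppose that one of the following holds: (i) $D$ is an algebraic division ring of characteristic zero; or (ii) $D$ is finite-dimensional over $F$, $F$ has characteristic $\ell>0$, and $\ell$ divides neither $\sqrt{\dim_F D}$ nor $n$. Then $$\mathrm{M}_n(D)=Z(\mathrm{M}_n(D))+\mathrm{span}_F\{p(AB)-p(BA)\mid A,B\in\mathrm{M}_n(D)\},$$ where $Z(\mathrm{M}_n(D))$ is the center of $\mathrm{M}_n(D)$.
   Context: A division ring $D$ is algebraic if every element of $D$ is a root of a nonzero polynomial with coefficients in the center of $D$. The sum of two subsets $X+Y$ means $\{x+y\mid x\in X,\ y\in Y\}$; $\mathrm{span}_F$ denotes $F$-linear span. *)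

theory Defs
  imports "HOL-Analysis.Analysis" "HOL-Computational_Algebra.Polynomial"
begin

definition center :: "'a::ring_1 set" where
  "center = {c. \<forall>x. c * x = x * c}"

text \<open>Evaluation of a polynomial (with central coefficients) at a ring element.\<close>
definition peval :: "'a::ring_1 poly \<Rightarrow> 'a \<Rightarrow> 'a" where
  "peval q x = (\<Sum>i\<le>degree q. coeff q i * x ^ i)"

definition algebraic_dr :: "'a::division_ring itself \<Rightarrow> bool" where
  "algebraic_dr _ \<longleftrightarrow> (\<forall>d::'a. \<exists>q. q \<noteq> 0 \<and> (\<forall>i. coeff q i \<in> center) \<and> peval q d = 0)"

definition center_basis :: "'a::division_ring set \<Rightarrow> bool" where
  "center_basis B \<longleftrightarrow> finite B \<and>
     (\<forall>x. \<exists>c. (\<forall>b\<in>B. c b \<in> center) \<and> x = (\<Sum>b\<in>B. c b * b)) \<and>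
     (\<forall>c. (\<forall>b\<in>B. c b \<in> center) \<and> (\<Sum>b\<in>B. c b * b) = 0 \<longrightarrow> (\<forall>b\<in>B. c b = 0))"

primrec matpow :: "'a::ring_1^'n^'n \<Rightarrow> nat \<Rightarrow> 'a^'n^'n" where
  "matpow M 0 = mat 1"
| "matpow M (Suc k) = M ** matpow M k"

definition mscale :: "'a::ring_1 \<Rightarrow> 'a^'n^'n \<Rightarrow> 'a^'n^'n" where
  "mscale c M = (\<chi> i j. c * M $ i $ j)"

text \<open>p(M) = sum of coeff_i * M^i (coefficients central).\<close>
definition mpeval :: "'a::ring_1 poly \<Rightarrow> 'a^'n^'n \<Rightarrow> 'a^'n^'n" where
  "mpeval q M = (\<Sum>i\<le>degree q. mscale (coeff q i) (matpow M i))"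

definition mat_center :: "('a::ring_1^'n^'n) set" where
  "mat_center = {Z. \<forall>X. Z ** X = X ** Z}"

definition span_F :: "('a::ring_1^'n^'n) set \<Rightarrow> ('a^'n^'n) set" where
  "span_F S = {(\<Sum>i<k. mscale (c i) (s i)) | (k::nat) (c::nat \<Rightarrow> 'a) (s::nat \<Rightarrow> 'a^'n^'n). \<forall>i<k. c i \<in> center \<and> s i \<in> S}"

end

theory Submission
  imports Defs
begin

text \<open>Let \<open>V\<close> be the span of the \<open>p(AB) - p(BA)\<close> and \<open>k\<close> the degree of \<open>p\<close>. Since the center \<open>F\<close> is infinite,
  \<open>V\<close> contains all \<open>(AB)\<^sup>k - (BA)\<^sup>k\<close>, hence all differences of rank one idempotents; modulo \<open>V\<close> every
  matrix is therefore congruent to its trace placed in one diagonal entry.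

  For the diagonal entry one works in \<open>D\<close>, using that the degree \<open>d\<close> of each \<open>a \<in> D\<close> over \<open>F\<close> is nonzero in
  \<open>F\<close> (in the finite-dimensional case \<open>d\<close> divides \<open>dim D\<close>). By Wedderburn's factorization of the minimal
  polynomial, \<open>d a\<close> is a central element plus commutators. Moreover the \<open>k\<close>-th powers span \<open>D\<close>
  (a separability argument through double centralizers), and \<open>(ab)\<^sup>k - (ba)\<^sup>k\<close> has the form \<open>z - g z g\<inverse>\<close>
  with \<open>z\<close> a \<open>k\<close>-th power, so all commutators occur.\<close>

section \<open>The center as a field\<close>

text \<open>As a type of its own the center becomes an instance of \<open>field\<close>, so that
  vector space theory and the finiteness of polynomial root sets apply to it.\<close>

typedef (overloaded) 'a center_field = "center :: 'a::division_ring set"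
  morphisms of_center to_center
proof
  show "0 \<in> center" by (simp add: center_def)
qed

setup_lifting type_definition_center_field

lemma center_iff: "c \<in> center \<longleftrightarrow> (\<forall>x. c * x = x * c)"
  by (simp add: center_def)

lemma of_center_commute: "of_center c * x = x * of_center c"
  using of_center[of c] by (simp add: center_iff)

lemma center_0 [simp]: "0 \<in> center"
  and center_1 [simp]: "1 \<in> center"
  and center_add: "x \<in> center \<Longrightarrow> y \<in> center \<Longrightarrow> x + y \<in> center"
  and center_diff: "x \<in> center \<Longrightarrow> y \<in> center \<Longrightarrow> x - y \<in> center"
  and center_uminus: "x \<in> center \<Longrightarrow> - x \<in> center"
  by (auto simp: center_iff algebra_simps)

lemma center_mult: "x \<in> center \<Longrightarrow> y \<in> center \<Longrightarrow> x * y \<in> center"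
  unfolding center_iff by (metis mult.assoc)

lemma center_power: "x \<in> center \<Longrightarrow> x ^ n \<in> center"
  by (induction n) (auto intro: center_mult)

lemma center_of_nat [simp]: "of_nat n \<in> center"
  by (simp add: center_iff mult_of_nat_commute)

lemma center_inverse:
  fixes x :: "'a::division_ring"
  assumes "x \<in> center"
  shows "inverse x \<in> center"
proof (cases "x = 0")
  case False
  have "inverse x * y = y * inverse x" for y
  proof -
    have "inverse x * y = inverse x * (y * x) * inverse x"
      using False by (simp add: mult.assoc)
    also have "y * x = x * y" using assms by (simp add: center_iff)
    also have "inverse x * (x * y) * inverse x = y * inverse x"
      using False by (simp add: mult.assoc[symmetric])
    finally show ?thesis .
  qed
  thus ?thesis by (simp add: center_iff)
qed auto

instantiation center_field :: (division_ring) field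
begin

lift_definition zero_center_field :: "'a center_field" is 0 by simp
lift_definition one_center_field :: "'a center_field" is 1 by simp
lift_definition plus_center_field :: "'a center_field \<Rightarrow> 'a center_field \<Rightarrow> 'a center_field"
  is "(+)" by (rule center_add)
lift_definition minus_center_field :: "'a center_field \<Rightarrow> 'a center_field \<Rightarrow> 'a center_field"
  is "(-)" by (rule center_diff)
lift_definition uminus_center_field :: "'a center_field \<Rightarrow> 'a center_field"
  is uminus by (rule center_uminus)
lift_definition times_center_field :: "'a center_field \<Rightarrow> 'a center_field \<Rightarrow> 'a center_field"
  is "(*)" by (rule center_mult)
lift_definition inverse_center_field :: "'a center_field \<Rightarrow> 'a center_field"
  is inverse by (rule center_inverse)

definition divide_center_field :: "'a center_field \<Rightarrow> 'a center_field \<Rightarrow> 'a center_field"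
  where "divide_center_field x y = x * inverse y"

instance
proof
  fix a b c :: "'a center_field"
  show "a * b = b * a" by transfer (metis center_iff)
  show "a * b * c = a * (b * c)" by transfer (rule mult.assoc)
  show "(a + b) * c = a * c + b * c" by transfer (rule distrib_right)
  show "1 * a = a" by transfer (rule mult_1)
  show "a + b + c = a + (b + c)" by transfer (rule add.assoc)
  show "a + b = b + a" by transfer (rule add.commute)
  show "0 + a = a" by transfer (rule add_0)
  show "- a + a = 0" by transfer (rule left_minus)
  show "a - b = a + - b" by transfer (rule diff_conv_add_uminus)
  show "(0 :: 'a center_field) \<noteq> 1" by transfer simp
  show "a \<noteq> 0 \<Longrightarrow> inverse a * a = 1" by transfer (rule left_inverse)
  show "a div b = a * inverse b" by (rule divide_center_field_def)
  show "inverse (0 :: 'a center_field) = 0" by transfer simp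
qed

end

lemma of_center_power: "of_center (c ^ n) = of_center c ^ n"
  by (induction n) (simp_all add: one_center_field.rep_eq times_center_field.rep_eq)

lemma of_center_eq_0_iff [simp]: "of_center c = 0 \<longleftrightarrow> c = 0"
  by (metis of_center_inject zero_center_field.rep_eq)

lemma infinite_center_field:
  assumes "infinite (center :: 'a::division_ring set)"
  shows "infinite (UNIV :: 'a center_field set)"
proof
  assume "finite (UNIV :: 'a center_field set)"
  hence "finite (range (of_center :: 'a center_field \<Rightarrow> 'a))" by simp
  moreover have "range (of_center :: 'a center_field \<Rightarrow> 'a) = center"
    by (rule type_definition.Rep_range[OF type_definition_center_field])
  ultimately show False using assms by simp
qed

section \<open>The division ring and its matrices as vector spaces over the center\<close>

definition cscale :: "'a::division_ring center_field \<Rightarrow> 'a \<Rightarrow> 'a"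
  where "cscale c x = of_center c * x"

definition mcscale :: "'a::division_ring center_field \<Rightarrow> 'a^'n^'n \<Rightarrow> 'a^'n^'n"
  where "mcscale c M = mscale (of_center c) M"

interpretation D: vector_space cscale
  by unfold_locales
    (auto simp: cscale_def algebra_simps plus_center_field.rep_eq times_center_field.rep_eq
      one_center_field.rep_eq)

interpretation M: vector_space mcscale
  by unfold_locales
    (auto simp: mcscale_def mscale_def vec_eq_iff algebra_simps plus_center_field.rep_eq
      times_center_field.rep_eq one_center_field.rep_eq)

section \<open>Separating the coefficients of a polynomial over an infinite field\<close>

lemma ex_power_distinct:
  assumes "infinite (UNIV :: 'a::field set)"
  shows "\<exists>\<alpha>::'a. \<forall>j<n. \<alpha> ^ j \<noteq> \<alpha> ^ n"
proof -
  have "finite {x::'a. x ^ j = x ^ n}" if "j < n" for j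
  proof -
    have "monom 1 j \<noteq> (monom 1 n :: 'a poly)"
      using that by (metis degree_monom_eq one_neq_zero less_irrefl)
    hence "finite {x. poly (monom 1 j - monom 1 n :: 'a poly) x = 0}"
      by (intro poly_roots_finite) simp
    thus ?thesis by (simp add: poly_monom)
  qed
  hence "finite (\<Union>j<n. {x::'a. x ^ j = x ^ n})" by simp
  then obtain \<alpha> :: 'a where "\<alpha> \<notin> (\<Union>j<n. {x. x ^ j = x ^ n})"
    using ex_new_if_finite[OF assms] by blast
  thus ?thesis by auto
qed

text \<open>A Vandermonde argument by induction: replacing \<open>t\<close> by
  \<open>\<alpha> * t\<close> and subtracting \<open>\<alpha> ^ Suc n\<close> times the original sum
  cancels the top term and multiplies each lower \<open>w j\<close> by a nonzero scalar.\<close>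

lemma (in vector_space) subspace_polynomial_coeff:
  assumes inf: "infinite (UNIV :: 'a set)" and W: "subspace W"
    and "\<And>t. (\<Sum>j\<le>n. scale (t ^ j) (w j)) \<in> W" and "j \<le> n"
  shows "w j \<in> W"
  using assms(3,4)
proof (induction n arbitrary: w j)
  case 0
  thus ?case using "0.prems"(1)[of 1] by simp
next
  case (Suc n)
  obtain \<alpha> :: 'a where \<alpha>: "\<forall>j<Suc n. \<alpha> ^ j \<noteq> \<alpha> ^ Suc n"
    using ex_power_distinct[OF inf] by blast
  have low: "w j \<in> W" if "j \<le> n" for j
  proof -
    let ?w = "\<lambda>j. scale (\<alpha> ^ j - \<alpha> ^ Suc n) (w j)"
    have "(\<Sum>j\<le>n. scale (t ^ j) (?w j)) \<in> W" for t
    proof -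
      have "(\<Sum>j\<le>Suc n. scale ((\<alpha> * t) ^ j) (w j)) -
          scale (\<alpha> ^ Suc n) (\<Sum>j\<le>Suc n. scale (t ^ j) (w j)) \<in> W"
        using Suc.prems(1) by (intro subspace_diff[OF W] subspace_scale[OF W])
      also have "(\<Sum>j\<le>Suc n. scale ((\<alpha> * t) ^ j) (w j)) -
          scale (\<alpha> ^ Suc n) (\<Sum>j\<le>Suc n. scale (t ^ j) (w j)) =
          (\<Sum>j\<le>Suc n. scale (t ^ j) (?w j))"
        unfolding scale_sum_right sum_subtractf[symmetric]
        by (intro sum.cong refl)
          (simp only: scale_left_diff_distrib scale_right_diff_distrib scale_scale
            power_mult_distrib mult.commute)
      finally show ?thesis by (simp only: sum.atMost_Suc diff_self scale_zero_left
        scale_zero_right add_0_right)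
    qed
    from Suc.IH[OF this that] have "scale (\<alpha> ^ j - \<alpha> ^ Suc n) (w j) \<in> W" .
    moreover have "\<alpha> ^ j - \<alpha> ^ Suc n \<noteq> 0" using \<alpha> that by (simp del: power_Suc)
    ultimately have "scale (inverse (\<alpha> ^ j - \<alpha> ^ Suc n) * (\<alpha> ^ j - \<alpha> ^ Suc n)) (w j) \<in> W"
      by (simp only: scale_scale[symmetric] subspace_scale[OF W])
    with \<open>\<alpha> ^ j - \<alpha> ^ Suc n \<noteq> 0\<close> show ?thesis by (metis left_inverse scale_one)
  qed
  show ?case
  proof (cases "j = Suc n")
    case True
    have "(\<Sum>j\<le>Suc n. scale (1 ^ j) (w j)) - (\<Sum>j\<le>n. w j) \<in> W"
      by (intro subspace_diff[OF W] subspace_sum[OF W] Suc.prems(1)) (simp add: low)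
    thus ?thesis using True by simp
  next
    case False
    thus ?thesis using low Suc.prems(2) by simp
  qed
qed

section \<open>Wedderburn's factorization and the double centralizer property\<close>

text \<open>\<open>d\<close> is the degree of \<open>a\<close> over the center; the relation is phrased for the right
  multiplications by \<open>a\<^sup>i\<close>, with linear independence over the whole division ring acting on the left.\<close>

locale minimal_relation =
  fixes a :: "'a::division_ring" and d :: nat and c :: "nat \<Rightarrow> 'a"
  assumes rel: "u * a ^ d = (\<Sum>i<d. c i * u * a ^ i)"
    and indep: "(\<And>u. (\<Sum>i<d. e i * u * a ^ i) = 0) \<Longrightarrow> i < d \<Longrightarrow> e i = 0"
begin

lemma degree_pos: "d > 0"
proof (rule ccontr)
  assume "\<not> d > 0"
  with rel[of 1] show False by simp
qed

text \<open>Comparing the relation at \<open>v * u\<close> with \<open>v\<close> times the relation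
  at \<open>u\<close> gives a relation with coefficients \<open>v * c i - c i * v\<close>, which
  vanish by \<open>indep\<close>.\<close>

lemma coeff_central: "i < d \<Longrightarrow> c i \<in> center"
proof -
  assume i: "i < d"
  have "v * c i - c i * v = 0" for v
  proof (rule indep[OF _ i])
    fix u
    have "(\<Sum>i<d. (v * c i - c i * v) * u * a ^ i) =
        v * (\<Sum>i<d. c i * u * a ^ i) - (\<Sum>i<d. c i * (v * u) * a ^ i)"
      by (simp add: sum_distrib_left sum_subtractf algebra_simps)
    also have "\<dots> = 0" by (simp only: rel[symmetric]) (simp add: mult.assoc)
    finally show "(\<Sum>i<d. (v * c i - c i * v) * u * a ^ i) = 0" .
  qed
  thus ?thesis by (auto simp: center_iff)
qed

lemma center_indep:
  assumes "\<And>i. i < d \<Longrightarrow> e i \<in> center" "(\<Sum>i<d. e i * a ^ i) = 0" "i < d"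
  shows "e i = 0"
proof (rule indep[OF _ assms(3)])
  fix u
  have "(\<Sum>i<d. e i * u * a ^ i) = u * (\<Sum>i<d. e i * a ^ i)"
    unfolding sum_distrib_left
    by (intro sum.cong refl) (metis assms(1) center_iff lessThan_iff mult.assoc)
  thus "(\<Sum>i<d. e i * u * a ^ i) = 0" using assms(2) by simp
qed

text \<open>With \<open>u = wed_arg i\<close> running over suitable elements, \<open>wed_root i\<close> is a conjugate \<open>a\<^sub>i\<close> of \<open>a\<close>, and
  \<open>wed_op j u\<close> is \<open>(h(u a u\<inverse>)) u\<close> for the skew polynomial
  \<open>h = (t - a\<^sub>j\<^sub>-\<^sub>1) \<dots> (t - a\<^sub>0)\<close>, whose coefficients are \<open>wed_coeff j\<close>.\<close>

fun wed_op :: "nat \<Rightarrow> 'a \<Rightarrow> 'a" where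
  "wed_op 0 u = u"
| "wed_op (Suc j) u =
     (let x = wed_op j (SOME v. wed_op j v \<noteq> 0)
      in wed_op j u * a - x * a * inverse x * wed_op j u)"

definition wed_arg :: "nat \<Rightarrow> 'a" where
  "wed_arg j = (SOME v. wed_op j v \<noteq> 0)"

definition wed_val :: "nat \<Rightarrow> 'a" where
  "wed_val j = wed_op j (wed_arg j)"

definition wed_root :: "nat \<Rightarrow> 'a" where
  "wed_root j = wed_val j * a * inverse (wed_val j)"

lemma wed_op_Suc: "wed_op (Suc j) u = wed_op j u * a - wed_root j * wed_op j u"
  by (simp add: wed_root_def wed_val_def wed_arg_def Let_def)

declare wed_op.simps(2) [simp del]

fun wed_coeff :: "nat \<Rightarrow> nat \<Rightarrow> 'a" where
  "wed_coeff 0 i = (if i = 0 then 1 else 0)"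
| "wed_coeff (Suc j) i = (if i = 0 then 0 else wed_coeff j (i - 1)) - wed_root j * wed_coeff j i"

lemma wed_coeff_gt: "i > j \<Longrightarrow> wed_coeff j i = 0"
  by (induction j arbitrary: i) auto

lemma wed_coeff_lead [simp]: "wed_coeff j j = 1"
  by (induction j) (auto simp: wed_coeff_gt)

lemma wed_coeff_subleading: "wed_coeff (Suc j) j = - (\<Sum>i\<le>j. wed_root i)"
  by (induction j) (auto simp: wed_coeff_gt)

lemma wed_op_eq: "wed_op j u = (\<Sum>i\<le>j. wed_coeff j i * u * a ^ i)"
proof (induction j)
  case (Suc j)
  have "(\<Sum>i\<le>Suc j. wed_coeff (Suc j) i * u * a ^ i) =
      (\<Sum>i\<le>Suc j. (if i = 0 then 0 else wed_coeff j (i - 1)) * u * a ^ i) -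
      wed_root j * (\<Sum>i\<le>Suc j. wed_coeff j i * u * a ^ i)"
    by (simp add: sum_distrib_left sum_subtractf algebra_simps del: sum.atMost_Suc)
  also have "(\<Sum>i\<le>Suc j. (if i = 0 then 0 else wed_coeff j (i - 1)) * u * a ^ i) =
      (\<Sum>i\<le>j. wed_coeff j i * u * a ^ i) * a"
    by (subst sum.atMost_Suc_shift)
      (simp add: sum_distrib_right mult.assoc power_commutes)
  also have "(\<Sum>i\<le>Suc j. wed_coeff j i * u * a ^ i) = (\<Sum>i\<le>j. wed_coeff j i * u * a ^ i)"
    by (simp add: wed_coeff_gt)
  finally show ?case by (simp only: wed_op_Suc Suc.IH)
qed auto

lemma wed_op_eq': "wed_op j u = u * a ^ j + (\<Sum>i<j. wed_coeff j i * u * a ^ i)"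
  by (simp add: wed_op_eq lessThan_Suc_atMost[symmetric])

text \<open>If \<open>wed_op j\<close> vanished identically, its coefficients, with leading one 1,
  would contradict \<open>indep\<close>. Hence the choice in \<open>wed_arg j\<close>
  succeeds.\<close>

lemma wed_val_nonzero:
  assumes "j < d"
  shows "wed_val j \<noteq> 0"
proof -
  have "\<exists>v. wed_op j v \<noteq> 0"
  proof (rule ccontr)
    assume *: "\<nexists>v. wed_op j v \<noteq> 0"
    have "(\<Sum>i<d. wed_coeff j i * u * a ^ i) = wed_op j u" for u
      unfolding wed_op_eq[of j u] using assms
      by (intro sum.mono_neutral_right) (auto simp: wed_coeff_gt)
    hence "(\<Sum>i<d. wed_coeff j i * u * a ^ i) = 0" for u using * by metis
    hence "wed_coeff j j = 0"
      by (intro indep[of "wed_coeff j", OF _ assms])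
    thus False by simp
  qed
  thus ?thesis unfolding wed_val_def wed_arg_def by (rule someI_ex)
qed

text \<open>The new factor is made to kill \<open>wed_arg j\<close>: with
  \<open>x = wed_val j\<close>, \<open>x * a - (x * a * inverse x) * x = 0\<close>. Arguments killed
  earlier stay killed.\<close>

lemma wed_op_arg_0:
  assumes "i < j" "j \<le> d"
  shows "wed_op j (wed_arg i) = 0"
  using assms
proof (induction j)
  case (Suc j)
  show ?case
  proof (cases "i = j")
    case True
    thus ?thesis using Suc.prems wed_val_nonzero[of j]
      by (simp add: wed_op_Suc wed_root_def mult.assoc wed_val_def[symmetric])
  next
    case False
    thus ?thesis using Suc by (simp add: wed_op_Suc)
  qed
qed auto

text \<open>A skew polynomial of degree below \<open>j\<close> vanishing at the first
  \<open>j\<close> arguments is zero. Splitting off the leading coefficient times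
  \<open>wed_op j\<close>, which kills the earlier arguments, leaves a remainder for the induction;
  evaluation at \<open>wed_arg j\<close> then kills the leading coefficient.\<close>

lemma coeffs_eq_0:
  assumes "\<And>k. k < j \<Longrightarrow> (\<Sum>i<j. e i * wed_arg k * a ^ i) = 0" "j \<le> d" "i < j"
  shows "e i = 0"
  using assms
proof (induction j arbitrary: e i)
  case (Suc j)
  define e' where "e' = (\<lambda>i. e i - e j * wed_coeff j i)"
  have split: "(\<Sum>i<Suc j. e i * u * a ^ i) = e j * wed_op j u + (\<Sum>i<j. e' i * u * a ^ i)" for u
    by (simp add: wed_op_eq' e'_def sum_distrib_left sum_subtractf algebra_simps)
  have e': "e' i = 0" if "i < j" for i
  proof (rule Suc.IH[OF _ _ that])
    fix k assume "k < j"
    thus "(\<Sum>i<j. e' i * wed_arg k * a ^ i) = 0"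
      using Suc.prems(1)[of k] Suc.prems(2) by (simp only: split) (simp add: wed_op_arg_0)
  qed (use Suc.prems in simp)
  have "(\<Sum>i<Suc j. e i * wed_arg j * a ^ i) = e j * wed_val j"
    unfolding split by (simp add: e' wed_val_def)
  hence "e j = 0" using Suc.prems(1)[of j] Suc.prems(2) wed_val_nonzero[of j] by simp
  thus ?case using e'[of i] Suc.prems(3) by (cases "i = j") (auto simp: e'_def)
qed auto

text \<open>Both \<open>wed_op d\<close> and the minimal relation are monic of degree
  \<open>d\<close> and vanish at all \<open>d\<close> arguments, so \<open>coeffs_eq_0\<close>
  applies to their difference.\<close>

lemma wed_coeff_final:
  assumes "i < d"
  shows "wed_coeff d i = - c i"
proof -
  have "wed_coeff d i + c i = 0"
  proof (rule coeffs_eq_0[OF _ order.refl assms])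
    fix k assume "k < d"
    thus "(\<Sum>i<d. (wed_coeff d i + c i) * wed_arg k * a ^ i) = 0"
      using wed_op_arg_0[of k d] unfolding wed_op_eq' rel
      by (simp add: sum.distrib algebra_simps)
  qed
  thus ?thesis by (simp add: eq_neg_iff_add_eq_0)
qed

lemma wed_op_final: "wed_op d u = 0"
  by (simp add: wed_op_eq' rel wed_coeff_final sum_negf)

text \<open>Wedderburn: the minimal polynomial of \<open>a\<close> is a product of linear factors
  \<open>t - b\<close> with \<open>b\<close> conjugate to \<open>a\<close>; this compares the second highest coefficients.\<close>

lemma sum_conjugates_central: "(\<Sum>i<d. wed_root i) \<in> center"
proof -
  obtain j where j: "d = Suc j" using degree_pos by (cases d) auto
  have "(\<Sum>i<d. wed_root i) = c j"
    using wed_coeff_final[of j] wed_coeff_subleading[of j]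
    by (simp add: j lessThan_Suc_atMost)
  thus ?thesis using coeff_central[of j] j by simp
qed

text \<open>With \<open>v = wed_val i\<close>, \<open>a - wed_root i\<close> is the commutator of
  \<open>a * inverse v\<close> and \<open>v\<close>. Summing over \<open>i < d\<close> leaves the
  central sum of the roots.\<close>

lemma mod_commutators:
  assumes add: "\<And>x y. x \<in> V \<Longrightarrow> y \<in> V \<Longrightarrow> x + y \<in> V" and "0 \<in> V"
    and comm: "\<And>x y. x * y - y * x \<in> V"
  shows "\<exists>z\<in>center. of_nat d * a - z \<in> V"
proof (rule bexI)
  have "a - wed_root i \<in> V" if "i < d" for i
    using comm[of "a * inverse (wed_val i)" "wed_val i"] wed_val_nonzero[OF that]
    by (simp add: wed_root_def mult.assoc)
  hence "(\<Sum>i\<in>I. a - wed_root i) \<in> V" if "I \<subseteq> {..<d}" for I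
    using that finite_subset[OF that]
    by (induction I rule: infinite_finite_induct) (auto intro: add assms(2))
  from this[of "{..<d}"] show "of_nat d * a - (\<Sum>i<d. wed_root i) \<in> V"
    by (simp add: sum_subtractf)
qed (rule sum_conjugates_central)

text \<open>The kernel of \<open>wed_op j\<close> is the right span of \<open>wed_arg i\<close>, \<open>i < j\<close>, over the centralizer of \<open>a\<close>.\<close>

lemma centralizer_linear_eq_0:
  assumes add: "\<And>x y. G (x + y) = G x + G y"
    and lin: "\<And>x z. z * a = a * z \<Longrightarrow> G (x * z) = G x * z"
    and "\<And>i. i < j \<Longrightarrow> G (wed_arg i) = 0" "j \<le> d" "wed_op j u = 0"
  shows "G u = 0"
  using assms(3-)
proof (induction j arbitrary: u)
  case 0
  have "G 0 = 0" using add[of 0 0] by simp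
  thus ?case using 0 by simp
next
  case (Suc j)
  define x where "x = wed_val j"
  have x: "x \<noteq> 0" using wed_val_nonzero[of j] Suc.prems by (simp add: x_def)
  define z where "z = inverse x * wed_op j u"
  have "wed_op j u * a = x * a * inverse x * wed_op j u"
    using Suc.prems(3) by (simp add: wed_op_Suc wed_root_def x_def)
  hence z: "z * a = a * z" using x by (simp add: z_def mult.assoc) (simp add: mult.assoc[symmetric])
  have za: "z * a ^ i = a ^ i * z" for i
    using power_commuting_commutes[OF z[symmetric]] by simp
  have "wed_op j (u - wed_arg j * z) = wed_op j u - wed_op j (wed_arg j) * z"
    by (simp add: wed_op_eq sum_subtractf[symmetric] sum_distrib_right algebra_simps za)
  also have "\<dots> = 0" using x by (simp add: wed_val_def[symmetric] x_def[symmetric] z_def mult.assoc[symmetric])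
  finally have op0: "wed_op j (u - wed_arg j * z) = 0" .
  have "G (u - wed_arg j * z) = 0"
    by (rule Suc.IH[OF _ _ op0]) (use Suc.prems(1,2) in simp_all)
  moreover have "G (wed_arg j * z) = 0" using lin[OF z] Suc.prems(1)[of j] by simp
  ultimately show ?case using add[of "u - wed_arg j * z" "wed_arg j * z"] by simp
qed

text \<open>Newton interpolation at the \<open>wed_arg k\<close> yields a skew polynomial that
  agrees there with right multiplication by \<open>y\<close>. Their difference \<open>G\<close> is
  linear over the centralizer of \<open>a\<close>, hence zero; centrality of the coefficients
  follows as in \<open>coeff_central\<close>.\<close>

lemma double_centralizer:
  assumes y: "\<And>z. z * a = a * z \<Longrightarrow> z * y = y * z"
  shows "\<exists>e. (\<forall>i<d. e i \<in> center) \<and> y = (\<Sum>i<d. e i * a ^ i)"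
proof -
  have "\<exists>e. \<forall>k<j. wed_arg k * y = (\<Sum>i<d. e i * wed_arg k * a ^ i)" if "j \<le> d" for j
    using that
  proof (induction j)
    case (Suc j)
    then obtain e where e: "\<forall>k<j. wed_arg k * y = (\<Sum>i<d. e i * wed_arg k * a ^ i)" by auto
    \<comment> \<open>Adding \<open>g * wed_op j\<close> corrects the value at
      \<open>wed_arg j\<close> and leaves the values at earlier arguments unchanged.\<close>
    define g where "g = (wed_arg j * y - (\<Sum>i<d. e i * wed_arg j * a ^ i)) * inverse (wed_val j)"
    have op: "(\<Sum>i<d. wed_coeff j i * u * a ^ i) = wed_op j u" for u
      unfolding wed_op_eq using Suc.prems
      by (intro sum.mono_neutral_right) (auto simp: wed_coeff_gt)
    have "(\<Sum>i<d. (e i + g * wed_coeff j i) * u * a ^ i) =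
        (\<Sum>i<d. e i * u * a ^ i) + g * wed_op j u" for u
      by (simp add: op[symmetric] sum.distrib sum_distrib_left algebra_simps)
    moreover have "g * wed_op j (wed_arg j) = wed_arg j * y - (\<Sum>i<d. e i * wed_arg j * a ^ i)"
      using wed_val_nonzero[of j] Suc.prems by (simp add: g_def wed_val_def mult.assoc)
    ultimately show ?case using e Suc.prems wed_op_arg_0[of _ j]
      by (intro exI[of _ "\<lambda>i. e i + g * wed_coeff j i"]) (simp add: less_Suc_eq)
  qed auto
  then obtain e where e: "\<And>k. k < d \<Longrightarrow> wed_arg k * y = (\<Sum>i<d. e i * wed_arg k * a ^ i)"
    by blast
  define G where "G = (\<lambda>u. u * y - (\<Sum>i<d. e i * u * a ^ i))"
  have "G u = 0" for u
  proof (rule centralizer_linear_eq_0[where G = G and j = d])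
    fix x z :: 'a assume z: "z * a = a * z"
    have za: "z * a ^ i = a ^ i * z" for i
      using power_commuting_commutes[OF z[symmetric]] by simp
    show "G (x * z) = G x * z"
      using y[OF z] by (simp add: G_def sum_distrib_right algebra_simps za)
  qed (use e wed_op_final in \<open>auto simp: G_def algebra_simps sum.distrib\<close>)
  hence eq: "u * y = (\<Sum>i<d. e i * u * a ^ i)" for u by (simp add: G_def)
  have "e i \<in> center" if i: "i < d" for i
  proof -
    have "v * e i - e i * v = 0" for v
    proof (rule indep[OF _ i])
      fix u
      have "(\<Sum>i<d. (v * e i - e i * v) * u * a ^ i) =
          v * (\<Sum>i<d. e i * u * a ^ i) - (\<Sum>i<d. e i * (v * u) * a ^ i)"
        by (simp add: sum_distrib_left sum_subtractf algebra_simps)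
      also have "\<dots> = 0" by (simp only: eq[symmetric]) (simp add: mult.assoc)
      finally show "(\<Sum>i<d. (v * e i - e i * v) * u * a ^ i) = 0" .
    qed
    thus ?thesis by (auto simp: center_iff)
  qed
  thus ?thesis using eq[of 1] by auto
qed

end

text \<open>\<open>d\<close> is the least length of a monic relation between the right
  multiplications, with arbitrary left coefficients; the given central relation shows that one
  exists, and minimality yields independence.\<close>

lemma ex_minimal_relation:
  fixes a :: "'a::division_ring"
  assumes "\<And>i. q i \<in> center" "(\<Sum>i\<le>n. q i * a ^ i) = 0" "q n \<noteq> 0"
  shows "\<exists>d c. minimal_relation a d c"
proof -
  define P where "P = (\<lambda>d. \<exists>c. \<forall>u. u * a ^ d = (\<Sum>i<d. c i * u * a ^ i))"
  have solve: "P j" if z: "\<And>u. (\<Sum>i\<le>j. e i * u * a ^ i) = 0" and "e j \<noteq> 0" for j e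
    unfolding P_def
  proof (intro exI allI)
    fix u
    have "e j * u * a ^ j = - (\<Sum>i<j. e i * u * a ^ i)"
      using z[of u] by (simp add: lessThan_Suc_atMost[symmetric] eq_neg_iff_add_eq_0 add.commute)
    hence "inverse (e j) * (e j * u * a ^ j) = inverse (e j) * (- (\<Sum>i<j. e i * u * a ^ i))" by simp
    also have "inverse (e j) * (e j * u * a ^ j) = u * a ^ j"
      using that(2) by (simp add: mult.assoc[symmetric])
    also have "inverse (e j) * (- (\<Sum>i<j. e i * u * a ^ i)) =
        (\<Sum>i<j. (- inverse (e j) * e i) * u * a ^ i)"
      by (simp add: sum_distrib_left sum_negf mult.assoc)
    finally show "u * a ^ j = (\<Sum>i<j. (- inverse (e j) * e i) * u * a ^ i)" .
  qed
  have "(\<Sum>i\<le>n. q i * u * a ^ i) = u * (\<Sum>i\<le>n. q i * a ^ i)" for u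
    unfolding sum_distrib_left
    by (intro sum.cong refl) (metis assms(1) center_iff mult.assoc)
  hence "P n" using assms by (intro solve[of q n]) auto
  define d where "d = (LEAST d. P d)"
  have "P d" unfolding d_def using \<open>P n\<close> by (rule LeastI)
  then obtain c where c: "\<And>u. u * a ^ d = (\<Sum>i<d. c i * u * a ^ i)" by (auto simp: P_def)
  have "e i = 0" if z: "\<And>u. (\<Sum>i<d. e i * u * a ^ i) = 0" and "i < d" for e i
  proof (rule ccontr)
    assume "e i \<noteq> 0"
    \<comment> \<open>Cutting the relation at its highest nonzero coefficient and solving for that
      power gives a monic relation shorter than \<open>d\<close>.\<close>
    define j where "j = Max {i. i < d \<and> e i \<noteq> 0}"
    have "j \<in> {i. i < d \<and> e i \<noteq> 0}" unfolding j_def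
      using \<open>e i \<noteq> 0\<close> \<open>i < d\<close> by (intro Max_in) auto
    hence j: "j < d" "e j \<noteq> 0" by auto
    have gt: "e k = 0" if "j < k" "k < d" for k
      using that Max_ge[of "{i. i < d \<and> e i \<noteq> 0}" k] unfolding j_def by fastforce
    have "(\<Sum>i\<le>j. e i * u * a ^ i) = (\<Sum>i<d. e i * u * a ^ i)" for u
      using j gt by (intro sum.mono_neutral_left) auto
    hence "P j" using z j by (intro solve[of e j]) auto
    hence "d \<le> j" unfolding d_def by (rule Least_le)
    thus False using j by simp
  qed
  thus ?thesis using c by (intro exI[of _ d] exI[of _ c]) (unfold_locales, auto)
qed

section \<open>Spans of powers\<close>

lemma mult_cscale: "x * cscale t y = cscale t (x * y)"
  unfolding cscale_def by (metis mult.assoc of_center_commute)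

lemma subspace_cancel_center:
  assumes "D.subspace W" "c \<in> center" "c \<noteq> 0" "c * x \<in> W"
  shows "x \<in> W"
proof -
  have "cscale (to_center (inverse c)) (c * x) \<in> W"
    by (rule D.subspace_scale[OF assms(1,4)])
  thus ?thesis using assms(2,3)
    by (simp add: cscale_def to_center_inverse center_inverse mult.assoc[symmetric])
qed

lemma subspace_center_mult:
  assumes "D.subspace W" "c \<in> center" "x \<in> W"
  shows "c * x \<in> W"
  using D.subspace_scale[OF assms(1,3), of "to_center c"] assms(2)
  by (simp add: cscale_def to_center_inverse)

text \<open>Pascal's rule in a form that serves both the binomial theorem, with
  \<open>T i j = x ^ i * y ^ j\<close>, and iterated commutators, with
  \<open>T i j = a ^ i * u * (- a) ^ j\<close>.\<close>

lemma funpow_binomial: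
  fixes T :: "nat \<Rightarrow> nat \<Rightarrow> 'a::ring_1"
  assumes add: "\<And>x y. f (x + y) = f x + f y"
    and step: "\<And>i j. f (T i j) = T (Suc i) j + T i (Suc j)"
  shows "(f ^^ m) (T 0 0) = (\<Sum>j\<le>m. of_nat (m choose j) * T j (m - j))"
proof (induction m)
  case (Suc m)
  have f0: "f 0 = 0" using add[of 0 0] by simp
  have f_nat: "f (of_nat n * x) = of_nat n * f x" for n x
    by (induction n) (simp_all add: f0 add distrib_right)
  have f_sum: "f (sum g A) = (\<Sum>x\<in>A. f (g x))" for g :: "nat \<Rightarrow> 'a" and A
    by (induction A rule: infinite_finite_induct) (simp_all add: f0 add)
  have "(\<Sum>j\<le>Suc m. of_nat (Suc m choose j) * T j (Suc m - j)) =
      (\<Sum>j\<le>m. of_nat (m choose j) * T (Suc j) (m - j)) +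
      (T 0 (Suc m) + (\<Sum>j\<le>m. of_nat (m choose Suc j) * T (Suc j) (m - j)))"
    by (subst sum.atMost_Suc_shift) (simp add: sum.distrib distrib_right)
  also have "T 0 (Suc m) + (\<Sum>j\<le>m. of_nat (m choose Suc j) * T (Suc j) (m - j)) =
      (\<Sum>j\<le>Suc m. of_nat (m choose j) * T j (Suc m - j))"
    by (subst sum.atMost_Suc_shift) simp
  also have "\<dots> = (\<Sum>j\<le>m. of_nat (m choose j) * T j (Suc (m - j)))"
    by (simp add: Suc_diff_le binomial_eq_0)
  finally show ?case
    by (simp add: Suc.IH f_sum f_nat step sum.distrib distrib_left)
qed auto

lemma add_power_commuting:
  fixes x y :: "'a::ring_1"
  assumes "x * y = y * x"
  shows "(x + y) ^ m = (\<Sum>j\<le>m. of_nat (m choose j) * (x ^ j * y ^ (m - j)))"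
proof -
  have "y * (x ^ i * y ^ j) = x ^ i * y ^ Suc j" for i j
    using power_commuting_commutes[OF assms, of i] by (simp add: mult.assoc[symmetric])
  hence "((*) (x + y) ^^ m) (x ^ 0 * y ^ 0) = (\<Sum>j\<le>m. of_nat (m choose j) * (x ^ j * y ^ (m - j)))"
    by (intro funpow_binomial) (simp_all add: distrib_left distrib_right mult.assoc)
  moreover have "((*) (x + y) ^^ m) z = (x + y) ^ m * z" for z
    by (induction m) (simp_all add: mult.assoc)
  ultimately show ?thesis by simp
qed

lemma iterated_commutator:
  fixes a u :: "'a::ring_1"
  shows "((\<lambda>x. a * x - x * a) ^^ m) u =
    (\<Sum>j\<le>m. of_nat (m choose j) * (a ^ j * u * (- a) ^ (m - j)))"
proof -
  have "((\<lambda>x. a * x - x * a) ^^ m) (a ^ 0 * u * (- a) ^ 0) =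
      (\<Sum>j\<le>m. of_nat (m choose j) * (a ^ j * u * (- a) ^ (m - j)))"
  proof (rule funpow_binomial[where T = "\<lambda>i j. a ^ i * u * (- a) ^ j"])
    fix i j
    show "a * (a ^ i * u * (- a) ^ j) - a ^ i * u * (- a) ^ j * a =
        a ^ Suc i * u * (- a) ^ j + a ^ i * u * (- a) ^ Suc j"
      by (simp only: power_Suc[of a] power_Suc2[of "- a"] mult.assoc mult_minus_right
        diff_conv_add_uminus)
  qed (simp add: algebra_simps)
  thus ?thesis by simp
qed

text \<open>The power rule for the derivation \<open>x * z - z * x\<close>, which maps
  \<open>a\<close> to 1.\<close>

lemma power_commutator:
  fixes a z :: "'a::ring_1"
  assumes "a * z - z * a = 1"
  shows "a ^ m * z - z * a ^ m = of_nat m * a ^ (m - 1)"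
proof (induction m)
  case (Suc m)
  have "a ^ Suc m * z - z * a ^ Suc m = a * (a ^ m * z - z * a ^ m) + (a * z - z * a) * a ^ m"
    by (simp add: algebra_simps)
  also have "\<dots> = of_nat m * (a * a ^ (m - 1)) + a ^ m"
    by (simp only: Suc.IH assms mult_1) (metis mult.assoc mult_of_nat_commute)
  also have "\<dots> = of_nat (Suc m) * a ^ m"
    by (cases m) (simp_all add: algebra_simps)
  finally show ?case by simp
qed auto

context minimal_relation
begin

text \<open>If \<open>az - za = 1\<close>, then the commutator with \<open>z\<close> differentiates polynomials in \<open>a\<close>, which turns
  the minimal relation into a shorter one.\<close>

lemma no_unit_commutator:
  assumes "of_nat d \<noteq> (0::'a)"
  shows "a * z - z * a \<noteq> 1"
proof
  assume z: "a * z - z * a = 1"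
  obtain d' where d: "d = Suc d'" using degree_pos by (cases d) auto
  have cz: "z * (c i * x) = c i * (z * x)" if "i < d" for i x
    using coeff_central[OF that] unfolding center_iff by (metis mult.assoc)
  have ad: "a ^ d = (\<Sum>i<d. c i * a ^ i)" using rel[of 1] by simp
  have "of_nat d * a ^ d' = a ^ d * z - z * a ^ d"
    using power_commutator[OF z, of d] by (simp add: d)
  also have "\<dots> = (\<Sum>i<d. c i * (a ^ i * z - z * a ^ i))"
    unfolding ad sum_distrib_left sum_distrib_right sum_subtractf[symmetric]
    by (intro sum.cong refl) (simp add: cz right_diff_distrib mult.assoc)
  also have "\<dots> = (\<Sum>i<d'. c (Suc i) * (of_nat (Suc i) * a ^ i))"
    unfolding power_commutator[OF z] d by (subst sum.lessThan_Suc_shift) simp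
  finally have eq: "of_nat d * a ^ d' = (\<Sum>i<d'. c (Suc i) * (of_nat (Suc i) * a ^ i))" .
  \<comment> \<open>The differentiated relation brought to one side; its top coefficient is
    \<open>of_nat d\<close>.\<close>
  define e where "e = (\<lambda>i. if i = d' then of_nat d else - (c (Suc i) * of_nat (Suc i)))"
  have "e d' = 0"
  proof (rule center_indep)
    have "(\<Sum>i<d'. e i * a ^ i) = - (\<Sum>i<d'. c (Suc i) * (of_nat (Suc i) * a ^ i))"
      unfolding sum_negf[symmetric]
      by (intro sum.cong refl) (simp add: e_def mult.assoc del: of_nat_Suc)
    thus "(\<Sum>i<d. e i * a ^ i) = 0"
      using eq by (simp add: d e_def del: of_nat_Suc)
    show "e i \<in> center" if "i < d" for i
      using that coeff_central[of "Suc i"]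
      by (auto simp: e_def d simp del: of_nat_Suc intro!: center_uminus center_mult)
  qed (simp add: d)
  thus False using assms by (simp add: e_def)
qed

text \<open>The vanishing binomial coefficients make \<open>i\<close>-th powers additive on commuting elements, so
  \<open>(ad a)\<^sup>i = ad (a\<^sup>i)\<close>: an element commuting with \<open>a\<^sup>i\<close> but not with \<open>a\<close> would yield a chain for \<open>ad a\<close>
  and hence some \<open>z\<close> with \<open>az - za = 1\<close>.\<close>

lemma commute_if_commute_power:
  assumes d: "of_nat d \<noteq> (0::'a)" and i: "i > 0"
    and binom: "\<And>j. 0 < j \<Longrightarrow> j < i \<Longrightarrow> of_nat (i choose j) = (0::'a)"
    and u: "u * a ^ i = a ^ i * u"
  shows "u * a = a * u"
proof (rule ccontr)
  assume neq: "u * a \<noteq> a * u"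
  define ad where "ad = (\<lambda>x. a * x - x * a)"
  have ad_i: "(ad ^^ i) x = a ^ i * x + x * (- a) ^ i" for x
  proof -
    have "(ad ^^ i) x = (\<Sum>j\<in>{0, i}. of_nat (i choose j) * (a ^ j * x * (- a) ^ (i - j)))"
      unfolding ad_def iterated_commutator
      using binom by (intro sum.mono_neutral_right) (auto simp: le_less)
    thus ?thesis using i by (simp add: add.commute)
  qed
  have "(ad ^^ m) 0 = 0" for m by (induction m) (simp_all add: ad_def)
  moreover have "ad 1 = 0" by (simp add: ad_def)
  ultimately have "(ad ^^ i) 1 = 0" using i
    by (cases i) (simp_all add: funpow_Suc_right del: funpow.simps)
  \<comment> \<open>Evaluating \<open>ad ^^ i\<close> at 1 settles the sign without cases on parity
    or characteristic.\<close>
  hence "(- a) ^ i = - (a ^ i)" using ad_i[of 1] by (simp add: eq_neg_iff_add_eq_0 add.commute)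
  hence ad_u: "(ad ^^ i) u = 0" using ad_i[of u] u by simp
  \<comment> \<open>Since \<open>n\<close> is at least 2, \<open>w = (ad ^^ (n - 2)) u\<close> has a
    nonzero commutator \<open>v\<close> with \<open>a\<close> that itself commutes with
    \<open>a\<close>, so \<open>w * inverse v\<close> has commutator 1.\<close>
  define n where "n = (LEAST n. (ad ^^ n) u = 0)"
  have n: "(ad ^^ n) u = 0" unfolding n_def using ad_u by (rule LeastI)
  have n_less: "(ad ^^ m) u \<noteq> 0" if "m < n" for m using that unfolding n_def by (rule not_less_Least)
  have "u \<noteq> 0" "ad u \<noteq> 0" using neq by (auto simp: ad_def)
  hence "n \<noteq> 0" "n \<noteq> Suc 0" using n by (metis funpow_0, auto)
  then obtain k where k: "n = Suc (Suc k)" by (metis not0_implies_Suc)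
  define w where "w = (ad ^^ k) u"
  define v where "v = a * w - w * a"
  have v0: "v \<noteq> 0" using n_less[of "Suc k"] by (simp add: k v_def w_def ad_def)
  have va: "a * v = v * a" using n by (simp add: k v_def w_def ad_def)
  have "inverse v * a = inverse v * (a * v) * inverse v" using v0 by (simp add: mult.assoc)
  also have "\<dots> = a * inverse v" unfolding va using v0 by (simp add: mult.assoc[symmetric])
  finally have "a * (w * inverse v) - w * inverse v * a = v * inverse v"
    by (simp add: v_def mult.assoc left_diff_distrib)
  thus False using no_unit_commutator[OF d, of "w * inverse v"] v0 by simp
qed

end

text \<open>The least \<open>i\<close> such that \<open>W\<close> contains all \<open>i\<close>-th powers satisfies the binomial condition above,
  hence \<open>a\<close> and \<open>a\<^sup>i\<close> have the same centralizer and \<open>a \<in> F[a\<^sup>i] \<subseteq> W\<close>.\<close>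

lemma subspace_powers_eq_UNIV:
  fixes W :: "'a::division_ring set"
  assumes inf: "infinite (center :: 'a set)"
    and deg: "\<And>a::'a. \<exists>d c. minimal_relation a d c \<and> of_nat d \<noteq> (0::'a)"
    and W: "D.subspace W" and k: "k > 0" "\<And>x. x ^ k \<in> W"
  shows "W = UNIV"
proof -
  define P where "P = (\<lambda>i. i > 0 \<and> (\<forall>y::'a. y ^ i \<in> W))"
  define i where "i = (LEAST i. P i)"
  have "P k" using k by (simp add: P_def)
  hence "P i" unfolding i_def by (rule LeastI)
  hence i: "i > 0" and iW: "y ^ i \<in> W" for y by (auto simp: P_def)
  have binom: "of_nat (i choose j) = (0::'a)" if j: "0 < j" "j < i" for j
  proof (rule ccontr)
    \<comment> \<open>Expanding \<open>(t + y) ^ i\<close> for central \<open>t\<close> and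
      extracting the coefficient of \<open>t ^ j\<close> would put all \<open>(i - j)\<close>-th
      powers into \<open>W\<close>, against the minimality of \<open>i\<close>.\<close>
    assume nz: "of_nat (i choose j) \<noteq> (0::'a)"
    have "y ^ (i - j) \<in> W" for y
    proof -
      have "(\<Sum>l\<le>i. cscale (t ^ l) (of_nat (i choose l) * y ^ (i - l))) \<in> W" for t
      proof -
        have "(\<Sum>l\<le>i. cscale (t ^ l) (of_nat (i choose l) * y ^ (i - l))) = (of_center t + y) ^ i"
          unfolding add_power_commuting[OF of_center_commute]
          by (intro sum.cong refl)
            (simp add: mult_cscale[symmetric], simp add: cscale_def of_center_power)
        thus ?thesis using iW by simp
      qed
      from D.subspace_polynomial_coeff[OF infinite_center_field[OF inf] W this, of j]
      have "of_nat (i choose j) * y ^ (i - j) \<in> W" using j by simp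
      thus ?thesis using nz by (rule subspace_cancel_center[OF W center_of_nat, rotated])
    qed
    hence "P (i - j)" using j by (simp add: P_def)
    hence "i \<le> i - j" unfolding i_def by (rule Least_le)
    thus False using j by simp
  qed
  have "a \<in> W" for a
  proof -
    obtain d c where "minimal_relation a d c" and d: "of_nat d \<noteq> (0::'a)" using deg by blast
    then interpret a: minimal_relation a d c by simp
    obtain d' c' where "minimal_relation (a ^ i) d' c'" using deg by blast
    then interpret b: minimal_relation "a ^ i" d' c' .
    obtain e where e: "\<And>j. j < d' \<Longrightarrow> e j \<in> center" "a = (\<Sum>j<d'. e j * (a ^ i) ^ j)"
      using b.double_centralizer[of a] a.commute_if_commute_power[OF d i binom] by blast
    have "(a ^ i) ^ j \<in> W" for j using iW[of "a ^ j"] by (simp add: power_mult[symmetric] mult.commute)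
    hence "(\<Sum>j<d'. e j * (a ^ i) ^ j) \<in> W"
      using e(1) by (intro D.subspace_sum[OF W] subspace_center_mult[OF W]) auto
    thus ?thesis using e(2) by simp
  qed
  thus ?thesis by auto
qed

section \<open>Degrees in the finite-dimensional and the algebraic case\<close>

text \<open>Coefficients are indexed by \<open>I\<close> rather than by the image, so
  \<open>f\<close> may have repeated values.\<close>

lemma (in module) span_image_finite:
  assumes "finite I" "x \<in> span (f ` I)"
  shows "\<exists>q. x = (\<Sum>i\<in>I. scale (q i) (f i))"
proof -
  let ?S = "{\<Sum>i\<in>I. scale (q i) (f i) | q. True}"
  have "f i \<in> ?S" if "i \<in> I" for i
    using that assms(1)
    by (intro CollectI exI[of _ "\<lambda>j. if j = i then 1 else 0"])
      (simp add: if_distrib[of "\<lambda>c. scale c _"] sum.delta' cong: if_cong)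
  moreover have "subspace ?S"
  proof (rule subspaceI)
    show "0 \<in> ?S" by (auto intro!: exI[of _ "\<lambda>_. 0"])
  next
    fix x y assume "x \<in> ?S" "y \<in> ?S"
    then obtain p q where "x = (\<Sum>i\<in>I. scale (p i) (f i))" "y = (\<Sum>i\<in>I. scale (q i) (f i))" by auto
    hence "x + y = (\<Sum>i\<in>I. scale (p i + q i) (f i))" by (simp add: scale_left_distrib sum.distrib)
    thus "x + y \<in> ?S" by auto
  next
    fix c x assume "x \<in> ?S"
    then obtain q where "x = (\<Sum>i\<in>I. scale (q i) (f i))" by auto
    hence "scale c x = (\<Sum>i\<in>I. scale (c * q i) (f i))" by (simp add: scale_sum_right)
    thus "scale c x \<in> ?S" by auto
  qed
  ultimately have "span (f ` I) \<subseteq> ?S" by (intro span_minimal) auto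
  thus ?thesis using assms(2) by auto
qed

text \<open>Otherwise the first \<open>n\<close> values would be distinct and independent for every
  \<open>n\<close>, exceeding \<open>card B\<close>.\<close>

lemma (in vector_space) ex_in_span_predecessors:
  fixes f :: "nat \<Rightarrow> 'b"
  assumes "finite B" "span B = UNIV"
  shows "\<exists>n. f n \<in> span (f ` {..<n})"
proof (rule ccontr)
  assume *: "\<nexists>n. f n \<in> span (f ` {..<n})"
  have "independent (f ` {..<n}) \<and> card (f ` {..<n}) = n" for n
  proof (induction n)
    case (Suc n)
    have "f n \<notin> span (f ` {..<n})" using * by blast
    moreover from this have "f n \<notin> f ` {..<n}"
      using span_base[of "f n" "f ` {..<n}"] by auto
    ultimately show ?case
      using Suc.IH independent_insertI[of "f n" "f ` {..<n}"] by (simp add: lessThan_Suc)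
  qed (simp add: independent_empty)
  from this[of "Suc (card B)"] independent_span_bound[OF assms(1), of "f ` {..<Suc (card B)}"] assms(2)
  show False by auto
qed

lemma center_basis_independent:
  assumes "center_basis B"
  shows "D.independent B"
proof (rule D.independent_if_scalars_zero)
  show "finite B" using assms by (simp add: center_basis_def)
next
  fix f x assume "(\<Sum>x\<in>B. cscale (f x) x) = 0" "x \<in> B"
  moreover have "\<forall>c. (\<forall>b\<in>B. c b \<in> center) \<and> (\<Sum>b\<in>B. c b * b) = 0 \<longrightarrow> (\<forall>b\<in>B. c b = 0)"
    using assms unfolding center_basis_def by (elim conjE)
  from this[THEN spec, of "\<lambda>b. of_center (f b)"]
  have "(\<Sum>b\<in>B. of_center (f b) * b) = 0 \<longrightarrow> (\<forall>b\<in>B. of_center (f b) = 0)"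
    by (simp add: of_center)
  ultimately have "of_center (f x) = 0" by (simp add: cscale_def)
  thus "f x = 0" by simp
qed

lemma center_basis_span:
  assumes "center_basis B"
  shows "D.span B = UNIV"
proof -
  have "x \<in> D.span B" for x
  proof -
    obtain c where c: "\<And>b. b \<in> B \<Longrightarrow> c b \<in> center" "x = (\<Sum>b\<in>B. c b * b)"
      using assms unfolding center_basis_def by blast
    show ?thesis unfolding c(2)
      by (intro D.span_sum subspace_center_mult D.subspace_span c(1) D.span_base)
  qed
  thus ?thesis by auto
qed

lemma ex_minimal_relation_finite_dim:
  fixes a :: "'a::division_ring"
  assumes "center_basis (B :: 'a set)"
  shows "\<exists>d c. minimal_relation a d c"
proof -
  have fin: "finite B" using assms by (simp add: center_basis_def)
  obtain n where "a ^ n \<in> D.span ((\<lambda>i. a ^ i) ` {..<n})"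
    using D.ex_in_span_predecessors[OF fin center_basis_span[OF assms]] by blast
  then obtain q where q: "a ^ n = (\<Sum>i<n. cscale (q i) (a ^ i))"
    using D.span_image_finite by blast
  define p where "p = (\<lambda>i. if i = n then 1 else - of_center (q i))"
  have "(\<Sum>i<n. p i * a ^ i) = - (a ^ n)"
    unfolding q sum_negf[symmetric] by (intro sum.cong refl) (simp add: p_def cscale_def)
  hence "(\<Sum>i\<le>n. p i * a ^ i) = 0"
    by (simp add: lessThan_Suc_atMost[symmetric] p_def)
  thus ?thesis
    by (rule ex_minimal_relation[rotated]) (auto simp: p_def intro: center_uminus of_center)
qed

lemma ex_minimal_relation_algebraic:
  fixes a :: "'a::division_ring"
  assumes "algebraic_dr TYPE('a)"
  shows "\<exists>d c. minimal_relation a d c"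
proof -
  obtain q where "q \<noteq> 0" "\<And>i. coeff q i \<in> center" "peval q a = 0"
    using assms unfolding algebraic_dr_def by blast
  thus ?thesis by (intro ex_minimal_relation[where q = "coeff q" and n = "degree q"]) (simp_all add: peval_def)
qed

section \<open>Divisibility of the dimension by the degree\<close>

context minimal_relation
begin

lemma power_multiples_eq_0:
  assumes "(\<Sum>i<d. cscale (q i) (a ^ i * e)) = 0" "e \<noteq> 0" "i < d"
  shows "q i = 0"
proof -
  have "(\<Sum>i<d. of_center (q i) * a ^ i) * e = 0"
    using assms(1) by (simp add: cscale_def sum_distrib_right mult.assoc)
  hence "(\<Sum>i<d. of_center (q i) * a ^ i) = 0" using assms(2) by simp
  hence "of_center (q i) = 0"
    using assms(3) of_center by (intro center_indep[of "\<lambda>i. of_center (q i)"])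
  thus ?thesis by simp
qed

text \<open>Together the two claims say that \<open>F[a] e\<close> has dimension \<open>d\<close>;
  independence alone concerns only the image set.\<close>

lemma power_multiples_independent:
  assumes "e \<noteq> 0"
  shows "inj_on (\<lambda>i. a ^ i * e) {..<d}" "D.independent ((\<lambda>i. a ^ i * e) ` {..<d})"
proof -
  show inj: "inj_on (\<lambda>i. a ^ i * e) {..<d}"
  proof (rule inj_onI, rule ccontr)
    fix i j assume ij: "i \<in> {..<d}" "j \<in> {..<d}" "a ^ i * e = a ^ j * e" "i \<noteq> j"
    define q :: "nat \<Rightarrow> 'a center_field" where
      "q = (\<lambda>k. if k = i then 1 else if k = j then -1 else 0)"
    have "(\<Sum>k<d. cscale (q k) (a ^ k * e)) = (\<Sum>k\<in>{i, j}. cscale (q k) (a ^ k * e))"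
      using ij by (intro sum.mono_neutral_right) (auto simp: q_def)
    also have "\<dots> = 0" using ij(3,4) by (simp add: q_def)
    finally have "q i = 0" using assms ij(1) by (intro power_multiples_eq_0[of q e i]) auto
    thus False by (simp add: q_def)
  qed
  show "D.independent ((\<lambda>i. a ^ i * e) ` {..<d})"
  proof (rule D.independent_if_scalars_zero)
    fix f x assume f: "(\<Sum>x\<in>(\<lambda>i. a ^ i * e) ` {..<d}. cscale (f x) x) = 0"
      and "x \<in> (\<lambda>i. a ^ i * e) ` {..<d}"
    then obtain i where "i < d" "x = a ^ i * e" by auto
    thus "f x = 0" using power_multiples_eq_0[of "\<lambda>i. f (a ^ i * e)" e i] f assms
      by (simp add: sum.reindex[OF inj])
  qed auto
qed

text \<open>A maximal \<open>F\<close>-subspace that is stable under left multiplication by \<open>a\<close> and has dimension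
  divisible by \<open>d\<close> is everything: otherwise add \<open>F[a] e\<close> for some \<open>e\<close> outside.\<close>

lemma degree_dvd_card_basis:
  assumes B: "center_basis (B :: 'a set)"
  shows "d dvd card B"
proof -
  have finB: "finite B" using B by (simp add: center_basis_def)
  interpret F: finite_dimensional_vector_space cscale B
    by unfold_locales (fact finB center_basis_independent[OF B] center_basis_span[OF B])+
  define S :: "'a set set" where "S = {U. D.subspace U \<and> (\<forall>x\<in>U. a * x \<in> U) \<and> d dvd D.dim U}"
  have "{0} \<in> S" by (simp add: S_def)
  moreover have "D.dim U \<le> card B" for U :: "'a set"
    using F.dim_subset_UNIV[of U] by (simp add: F.dimension_def)
  ultimately obtain U where U: "U \<in> S" "\<And>V. V \<in> S \<Longrightarrow> D.dim V \<le> D.dim U"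
    using ex_has_greatest_nat[of "\<lambda>U. U \<in> S" "{0}" D.dim "Suc (card B)"] by (auto simp: less_Suc_eq_le)
  hence subU: "D.subspace U" and aU: "\<And>x. x \<in> U \<Longrightarrow> a * x \<in> U" and dU: "d dvd D.dim U"
    by (auto simp: S_def)
  have "U = UNIV"
  proof (rule ccontr)
    assume "U \<noteq> UNIV"
    then obtain e where e: "e \<notin> U" by auto
    hence e0: "e \<noteq> 0" using D.subspace_0[OF subU] by auto
    define X where "X = D.span ((\<lambda>i. a ^ i * e) ` {..<d})"
    have subX: "D.subspace X" unfolding X_def by (rule D.subspace_span)
    have dimX: "D.dim X = d" unfolding X_def
      using D.dim_span_eq_card_independent[OF power_multiples_independent(2)[OF e0]]
        card_image[OF power_multiples_independent(1)[OF e0]] by simp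
    have aiU: "a ^ i * x \<in> U" if "x \<in> U" for i x
      by (induction i) (simp_all add: that aU mult.assoc)
    have aX: "a * x \<in> X" if "x \<in> X" for x
    proof -
      obtain q where q: "x = (\<Sum>i<d. cscale (q i) (a ^ i * e))"
        using D.span_image_finite \<open>x \<in> X\<close> unfolding X_def by blast
      have base0: "a ^ i * e \<in> X" if "i < d" for i
        using that by (auto simp: X_def intro!: D.span_base)
      have base: "a ^ i * e \<in> X" if "i \<le> d" for i
      proof (cases "i = d")
        case True
        have "a ^ d * e = (\<Sum>i<d. c i * (a ^ i * e))"
          using rel[of 1] by (simp add: sum_distrib_right mult.assoc)
        also have "\<dots> \<in> X"
          by (intro D.subspace_sum[OF subX])
            (simp add: subspace_center_mult[OF subX] coeff_central base0)
        finally show ?thesis using True by simp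
      qed (use that base0 in simp)
      have "a * x = (\<Sum>i<d. cscale (q i) (a ^ Suc i * e))"
        by (simp add: q sum_distrib_left mult_cscale mult.assoc)
      also have "\<dots> \<in> X"
        by (intro D.subspace_sum[OF subX] D.subspace_scale[OF subX] base) auto
      finally show ?thesis .
    qed
    \<comment> \<open>A nonzero common element is \<open>g * e\<close> with \<open>g\<close> in
      \<open>F[a]\<close>. Left multiplication by \<open>g\<close> is injective and maps
      \<open>U\<close> into itself, hence onto by dimension; so \<open>g * e = g * y\<close> with
      \<open>y\<close> in \<open>U\<close>, forcing \<open>e\<close> into \<open>U\<close>.\<close>
    have "U \<inter> X = {0}"
    proof -
      have "x = 0" if "x \<in> U" "x \<in> X" for x
      proof (rule ccontr)
        assume "x \<noteq> 0"
        obtain q where q: "x = (\<Sum>i<d. cscale (q i) (a ^ i * e))"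
          using D.span_image_finite \<open>x \<in> X\<close> unfolding X_def by blast
        define g where "g = (\<Sum>i<d. of_center (q i) * a ^ i)"
        have x: "x = g * e" by (simp add: q g_def cscale_def sum_distrib_right mult.assoc)
        hence g0: "g \<noteq> 0" using \<open>x \<noteq> 0\<close> by auto
        have gU: "g * y \<in> U" if "y \<in> U" for y
        proof -
          have "g * y = (\<Sum>i<d. cscale (q i) (a ^ i * y))"
            by (simp add: g_def cscale_def sum_distrib_right mult.assoc)
          thus ?thesis using that
            by (simp add: D.subspace_sum[OF subU] D.subspace_scale[OF subU] aiU)
        qed
        have lin: "Vector_Spaces.linear cscale cscale ((*) g)"
          by unfold_locales (simp_all add: distrib_left mult_cscale)
        interpret g: Vector_Spaces.linear cscale cscale "(*) g" by (rule lin)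
        interpret FP: finite_dimensional_vector_space_pair_1 cscale B cscale by unfold_locales
        have "D.dim ((*) g ` U) = D.dim U"
          using g0 by (intro FP.dim_image_eq[OF lin]) (auto simp: inj_on_def)
        hence "(*) g ` U = U" using gU
          by (intro F.subspace_dim_equal g.subspace_image subU) auto
        hence "x \<in> (*) g ` U" using that by simp
        then obtain y where "y \<in> U" "g * e = g * y" using x by auto
        hence "e \<in> U" using g0 by simp
        thus False using e by simp
      qed
      thus ?thesis using D.subspace_0[OF subU] D.subspace_0[OF subX] by auto
    qed
    hence dim_eq: "D.dim {x + y |x y. x \<in> U \<and> y \<in> X} = D.dim U + d"
      using F.dim_sums_Int[OF subU subX] dimX by simp
    have "{x + y |x y. x \<in> U \<and> y \<in> X} \<in> S"
      unfolding S_def using D.subspace_sums[OF subU subX] dim_eq dU aU aX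
      by (auto simp: distrib_left) blast
    from U(2)[OF this] show False using dim_eq degree_pos by simp
  qed
  thus ?thesis using dU F.dim_UNIV by simp
qed

end

text \<open>In characteristic zero \<open>d > 0\<close> suffices; otherwise \<open>d\<close> divides
  \<open>m ^ 2\<close>, which is nonzero in the center.\<close>

lemma ex_minimal_relation_nonzero_degree:
  fixes a :: "'a::division_ring"
  assumes "(algebraic_dr TYPE('a) \<and> CHAR('a) = 0) \<or>
    (\<exists>B::'a set. center_basis B \<and> (\<exists>m. m ^ 2 = card B \<and> \<not> CHAR('a) dvd m))"
  shows "\<exists>d c. minimal_relation a d c \<and> of_nat d \<noteq> (0::'a)"
  using assms
proof (elim disjE conjE exE)
  assume "algebraic_dr TYPE('a)" and char0: "CHAR('a) = 0"
  then obtain d c where dc: "minimal_relation a d c" using ex_minimal_relation_algebraic by blast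
  hence "d > 0" by (rule minimal_relation.degree_pos)
  thus ?thesis using dc char0 by (auto simp: of_nat_eq_0_iff_char_dvd)
next
  fix B :: "'a set" and m assume B: "center_basis B" and m: "m ^ 2 = card B" "\<not> CHAR('a) dvd m"
  obtain d c where dc: "minimal_relation a d c" using ex_minimal_relation_finite_dim[OF B] by blast
  hence "d dvd m ^ 2" using minimal_relation.degree_dvd_card_basis[OF dc B] m(1) by simp
  then obtain k where k: "m ^ 2 = d * k" by auto
  have "of_nat m ^ 2 \<noteq> (0::'a)" using m(2) by (simp add: of_nat_eq_0_iff_char_dvd)
  hence "of_nat d \<noteq> (0::'a)" using k by (metis mult_zero_left of_nat_mult of_nat_power)
  thus ?thesis using dc by blast
qed

section \<open>Matrices\<close>

lemma matrix_mscale_left: "mscale t A ** B = mscale t (A ** B)"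
  by (simp add: mscale_def matrix_matrix_mult_def vec_eq_iff sum_distrib_left mult.assoc)

lemma matrix_mscale_right:
  assumes "t \<in> center"
  shows "B ** mscale t A = mscale t (B ** A)"
proof -
  have "x * (t * y) = t * (x * y)" for x y
    using assms unfolding center_iff by (metis mult.assoc)
  thus ?thesis
    by (simp add: mscale_def matrix_matrix_mult_def vec_eq_iff sum_distrib_left)
qed

lemma matpow_mscale:
  assumes "t \<in> center"
  shows "matpow (mscale t A) k = mscale (t ^ k) (matpow A k)"
proof (induction k)
  case (Suc k)
  thus ?case
    by (simp add: matrix_mscale_left matrix_mscale_right center_power assms)
      (simp add: mscale_def mult.assoc)
qed (simp add: mscale_def vec_eq_iff)

lemma matpow_idempotent:
  assumes "A ** A = A" "k > 0"
  shows "matpow A k = A"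
proof -
  have "matpow A (Suc j) = A" for j by (induction j) (simp_all add: assms(1))
  thus ?thesis using assms(2) by (metis gr0_implies_Suc)
qed

lemma subspace_span_F: "M.subspace (span_F S)"
proof (rule M.subspaceI)
  show "0 \<in> span_F S" by (auto simp: span_F_def intro!: exI[of _ "0::nat"])
next
  fix x y assume xy: "x \<in> span_F S" "y \<in> span_F S"
  obtain k :: nat and c s where
    x: "x = (\<Sum>i<k. mscale (c i) (s i))" "\<forall>i<k. c i \<in> center \<and> s i \<in> S"
    using xy(1) unfolding span_F_def by blast
  obtain l :: nat and e r where
    y: "y = (\<Sum>i<l. mscale (e i) (r i))" "\<forall>i<l. e i \<in> center \<and> r i \<in> S"
    using xy(2) unfolding span_F_def by blast
  define c' where "c' = (\<lambda>i. if i < k then c i else e (i - k))"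
  define s' where "s' = (\<lambda>i. if i < k then s i else r (i - k))"
  have add: "(\<Sum>i<k + m. f i) = (\<Sum>i<k. f i) + (\<Sum>i<m. f (k + i))" for m and f :: "nat \<Rightarrow> 'a^'b^'b"
    by (induction m) (simp_all add: add.assoc)
  have "x + y = (\<Sum>i<k + l. mscale (c' i) (s' i))"
    unfolding add x y by (simp add: c'_def s'_def)
  moreover have "\<forall>i<k + l. c' i \<in> center \<and> s' i \<in> S"
    using x(2) y(2) by (auto simp: c'_def s'_def)
  ultimately show "x + y \<in> span_F S" unfolding span_F_def by blast
next
  fix t x assume "x \<in> span_F S"
  then obtain k :: nat and c s where
    x: "x = (\<Sum>i<k. mscale (c i) (s i))" "\<forall>i<k. c i \<in> center \<and> s i \<in> S"
    unfolding span_F_def by blast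
  have "mcscale t x = (\<Sum>i<k. mscale (of_center t * c i) (s i))"
    unfolding x M.scale_sum_right
    by (intro sum.cong refl) (simp add: mcscale_def mscale_def mult.assoc)
  moreover have "\<forall>i<k. of_center t * c i \<in> center \<and> s i \<in> S"
    using x(2) by (auto intro: center_mult of_center)
  ultimately show "mcscale t x \<in> span_F S"
    unfolding span_F_def by (intro CollectI exI[of _ k] exI[of _ "\<lambda>i. of_center t * c i"] exI[of _ s]) blast
qed

lemma span_F_base: "x \<in> S \<Longrightarrow> x \<in> span_F S"
  unfolding span_F_def
  by (intro CollectI exI[of _ 1] exI[of _ "\<lambda>_. 1"] exI[of _ "\<lambda>_. x"]) (simp add: mscale_def)

text \<open>Replacing \<open>A\<close> by \<open>t A\<close> with \<open>t\<close> central separates the homogeneous components of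
  \<open>p(AB) - p(BA)\<close>.\<close>

lemma matpow_diff_in_span:
  fixes p :: "'a::division_ring poly" and A B :: "'a^'n^'n"
  assumes inf: "infinite (center :: 'a set)"
    and p: "\<forall>i. coeff p i \<in> center" "degree p > 0"
  shows "matpow (A ** B) (degree p) - matpow (B ** A) (degree p) \<in>
    span_F {mpeval p (A ** B) - mpeval p (B ** A) | A B :: 'a^'n^'n. True}" (is "_ \<in> ?V")
proof -
  define k where "k = degree p"
  define w where "w = (\<lambda>i. mscale (coeff p i) (matpow (A ** B) i - matpow (B ** A) i))"
  have "(\<Sum>i\<le>k. mcscale (t ^ i) (w i)) \<in> ?V" for t
  proof -
    let ?t = "of_center t"
    have "(\<Sum>i\<le>k. mcscale (t ^ i) (w i)) = mpeval p (mscale ?t A ** B) - mpeval p (B ** mscale ?t A)"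
      unfolding mpeval_def sum_subtractf[symmetric] k_def
    proof (intro sum.cong refl)
      fix i
      have comm: "?t ^ i * (coeff p i * x) = coeff p i * (?t ^ i * x)" for x
        using p(1) unfolding center_iff by (metis mult.assoc)
      show "mcscale (t ^ i) (w i) = mscale (coeff p i) (matpow (mscale ?t A ** B) i) -
          mscale (coeff p i) (matpow (B ** mscale ?t A) i)"
        unfolding matrix_mscale_left matrix_mscale_right[OF of_center] matpow_mscale[OF of_center]
        by (simp add: w_def mcscale_def mscale_def of_center_power vec_eq_iff right_diff_distrib comm)
    qed
    thus ?thesis by (auto intro!: span_F_base)
  qed
  hence "w k \<in> ?V"
    by (rule M.subspace_polynomial_coeff[OF infinite_center_field[OF inf] subspace_span_F]) simp
  hence "mcscale (to_center (inverse (coeff p k))) (w k) \<in> ?V"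
    by (rule M.subspace_scale[OF subspace_span_F])
  moreover have "coeff p k \<noteq> 0" using p(2) unfolding k_def by (metis degree_0 leading_coeff_0_iff less_irrefl)
  hence "mcscale (to_center (inverse (coeff p k))) (w k) = matpow (A ** B) k - matpow (B ** A) k"
    using p(1) by (simp add: w_def mcscale_def mscale_def to_center_inverse center_inverse
      mult.assoc[symmetric] vec_eq_iff)
  ultimately show ?thesis by (simp add: k_def)
qed

section \<open>Matrix units and reduction to a single diagonal entry\<close>

definition munit :: "'n \<Rightarrow> 'n \<Rightarrow> 'a::ring_1 \<Rightarrow> 'a^'n^'n" where
  "munit i j x = (\<chi> r s. if r = i \<and> s = j then x else 0)"

lemma munit_mult: "munit i j x ** munit k l y = (if j = k then munit i l (x * y) else 0)"
  by (auto simp: munit_def matrix_matrix_mult_def vec_eq_iff if_distrib[of "\<lambda>z. z * _"]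
      if_distrib[of "\<lambda>z. _ * z"] sum.delta cong: if_cong)

lemma munit_0 [simp]: "munit i j 0 = 0"
  and munit_add: "munit i j (x + y) = munit i j x + munit i j y"
  and munit_diff: "munit i j (x - y) = munit i j x - munit i j y"
  and munit_mscale: "munit i j (c * x) = mscale c (munit i j x)"
  by (auto simp: munit_def mscale_def vec_eq_iff)

lemma munit_sum: "munit i j (sum f I) = (\<Sum>x\<in>I. munit i j (f x))"
  by (induction I rule: infinite_finite_induct) (simp_all add: munit_add)

lemma matrix_eq_sum_munit: "X = (\<Sum>i\<in>UNIV. \<Sum>j\<in>UNIV. munit i j (X $ i $ j))"
proof -
  have "(\<Sum>i\<in>UNIV. \<Sum>j\<in>UNIV. munit i j (X $ i $ j)) $ r $ s = X $ r $ s" for r s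
  proof -
    have "(\<Sum>j\<in>UNIV. if r = i \<and> s = j then X $ i $ j else 0) = (if r = i then X $ i $ s else 0)" for i
      by (cases "r = i") simp_all
    hence "(\<Sum>i\<in>UNIV. \<Sum>j\<in>UNIV. munit i j (X $ i $ j)) $ r $ s =
        (\<Sum>i\<in>UNIV. if r = i then X $ i $ s else 0)"
      by (simp add: munit_def sum_component)
    thus ?thesis by simp
  qed
  thus ?thesis by (simp add: vec_eq_iff)
qed

lemma subspace_munit: "M.subspace V \<Longrightarrow> D.subspace {x. munit i j x \<in> V}"
  using M.subspace_scale[of V]
  by (intro D.subspaceI)
    (auto simp: munit_add M.subspace_0 M.subspace_add cscale_def munit_mscale mcscale_def)

lemma matpow_munit:
  assumes "k > 0"
  shows "matpow (munit i i x) k = munit i i (x ^ k)"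
proof -
  have "matpow (munit i i x) (Suc j) = munit i i (x ^ Suc j)" for j
    by (induction j) (simp_all add: munit_mult)
  thus ?thesis using assms by (metis gr0_implies_Suc)
qed

text \<open>For \<open>y\<close> nonzero, \<open>a = z * inverse y\<close> and \<open>b = y\<close>
  put every \<open>z ^ k\<close> into \<open>W\<close>, so \<open>W\<close> is everything.
  Membership of \<open>x * y\<close> in \<open>W\<close> is the claim.\<close>

lemma subspace_contains_commutators:
  fixes V :: "'a::division_ring set"
  assumes inf: "infinite (center :: 'a set)"
    and deg: "\<And>a::'a. \<exists>d c. minimal_relation a d c \<and> of_nat d \<noteq> (0::'a)"
    and V: "D.subspace V" and k: "k > 0" "\<And>a b. (a * b) ^ k - (b * a) ^ k \<in> V"
  shows "x * y - y * x \<in> V"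
proof (cases "y = 0")
  case True
  thus ?thesis using D.subspace_0[OF V] by simp
next
  case False
  define W where "W = {z. z - y * z * inverse y \<in> V}"
  have "W = UNIV"
  proof (rule subspace_powers_eq_UNIV[OF inf deg _ k(1)])
    show "D.subspace W"
    proof (rule D.subspaceI)
      fix u v assume "u \<in> W" "v \<in> W"
      thus "u + v \<in> W" using D.subspace_add[OF V, of "u - y * u * inverse y" "v - y * v * inverse y"]
        by (simp add: W_def algebra_simps)
    next
      fix t u assume "u \<in> W"
      hence "cscale t (u - y * u * inverse y) \<in> V" unfolding W_def by (auto intro: D.subspace_scale[OF V])
      thus "cscale t u \<in> W"
        by (simp add: W_def D.scale_right_diff_distrib mult_cscale) (simp add: cscale_def mult.assoc)
    qed (simp add: W_def D.subspace_0[OF V])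
  next
    fix z
    have "(y * z * inverse y) ^ m = y * z ^ m * inverse y" for m
    proof (induction m)
      case (Suc m)
      have "(y * z * inverse y) ^ Suc m = y * z * inverse y * (y * z ^ m * inverse y)"
        by (simp only: power_Suc Suc.IH)
      also have "\<dots> = y * z * (inverse y * y) * z ^ m * inverse y"
        by (simp only: mult.assoc)
      finally show ?case using False by (simp add: mult.assoc)
    qed (use False in simp)
    thus "z ^ k \<in> W" using k(2)[of "z * inverse y" y] False
      by (simp add: W_def mult.assoc)
  qed
  hence "x * y \<in> W" by simp
  thus ?thesis using False by (simp add: W_def mult.assoc)
qed

lemma matrix_add_rdistrib: "((A :: 'a::semiring_1^'n^'m) + B) ** C = A ** C + B ** C"
  by (simp add: matrix_matrix_mult_def vec_eq_iff distrib_right sum.distrib)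

text \<open>\<open>A\<close> is the column \<open>(1 - x * y, y)\<close> and \<open>B\<close> the
  row \<open>(1, x)\<close>, whose product in the order row times column is 1; hence
  \<open>A ** B\<close> is idempotent.\<close>

lemma rank_one_idempotents:
  fixes i j :: "'n::finite" and x y :: "'a::ring_1"
  assumes "i \<noteq> j"
  defines "A \<equiv> munit i i (1 - x * y) + munit j i y" and "B \<equiv> munit i i 1 + munit i j x"
  shows "A ** B = munit i i (1 - x * y) + munit i j ((1 - x * y) * x) + munit j i y + munit j j (y * x)"
    and "B ** A = munit i i 1"
    and "(A ** B) ** (A ** B) = A ** B" and "(B ** A) ** (B ** A) = B ** A"
proof -
  show "A ** B = munit i i (1 - x * y) + munit i j ((1 - x * y) * x) + munit j i y + munit j j (y * x)"
    using assms(1) by (simp add: A_def B_def matrix_add_ldistrib matrix_add_rdistrib munit_mult add_ac)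
  show BA: "B ** A = munit i i 1"
    using assms(1) by (simp add: A_def B_def matrix_add_ldistrib matrix_add_rdistrib munit_mult munit_add[symmetric])
  have "A ** munit i i 1 = A"
    by (simp add: A_def matrix_add_rdistrib munit_mult)
  thus "(A ** B) ** (A ** B) = A ** B" by (metis BA matrix_mul_assoc)
  show "(B ** A) ** (B ** A) = B ** A" by (simp add: BA munit_mult)
qed

lemma subspace_contains_traceless:
  fixes V :: "('a::division_ring^'n^'n) set"
  assumes V: "M.subspace V" and k: "k > 0"
    and diff: "\<And>A B. matpow (A ** B) k - matpow (B ** A) k \<in> V"
    and tr: "munit i0 i0 (\<Sum>i\<in>UNIV. X $ i $ i) \<in> V"
  shows "X \<in> V"
proof -
  have idem: "munit i i (1 - x * y) + munit i j ((1 - x * y) * x) + munit j i y + munit j j (y * x) -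
      munit i i 1 \<in> V" if "i \<noteq> j" for i j x y
  proof -
    note r = rank_one_idempotents[OF that, of x y]
    show ?thesis
      using diff[of "munit i i (1 - x * y) + munit j i y" "munit i i 1 + munit i j x"]
      unfolding matpow_idempotent[OF r(3) k] matpow_idempotent[OF r(4) k] unfolding r(1,2) .
  qed
  \<comment> \<open>Taking \<open>y = 0\<close> leaves only the off-diagonal entry
    \<open>x\<close>.\<close>
  have off: "munit i j x \<in> V" if "i \<noteq> j" for i j x
    using idem[OF that, of x 0] by simp
  \<comment> \<open>Taking \<open>y = 1\<close> gives this difference up to off-diagonal
    terms.\<close>
  have diag: "munit j j x - munit i i x \<in> V" if "i \<noteq> j" for i j x
  proof -
    have "(munit i i (1 - x * 1) + munit i j ((1 - x * 1) * x) + munit j i 1 + munit j j (1 * x) -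
        munit i i 1) - munit i j ((1 - x * 1) * x) - munit j i 1 \<in> V"
      using that by (intro M.subspace_diff[OF V] idem off) auto
    thus ?thesis by (simp add: munit_diff)
  qed
  \<comment> \<open>Each diagonal entry is moved to position \<open>(i0, i0)\<close>, where the
    entries add up to the trace.\<close>
  have "X = (\<Sum>i\<in>UNIV. \<Sum>j\<in>UNIV. munit i j (X $ i $ j) - (if j = i then munit i0 i0 (X $ i $ i) else 0)) +
      munit i0 i0 (\<Sum>i\<in>UNIV. X $ i $ i)"
    by (subst matrix_eq_sum_munit[of X]) (simp add: sum_subtractf munit_sum)
  also have "\<dots> \<in> V"
  proof (intro M.subspace_add[OF V] M.subspace_sum[OF V] tr)
    fix i j
    show "munit i j (X $ i $ j) - (if j = i then munit i0 i0 (X $ i $ i) else 0) \<in> V"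
      using off[of i j] diag[of i0 i] M.subspace_0[OF V] by (cases "i = j"; cases "i = i0") auto
  qed
  finally show ?thesis .
qed

theorem theorem4p11:
  fixes p :: "'a::division_ring poly"
    and typ_n :: "'n::finite itself"
  assumes inf_center: "infinite (center :: 'a set)"
    and p_central: "\<forall>i. coeff p i \<in> center"
    and p_nonconst: "degree p > 0"
    and cases:
      "(algebraic_dr TYPE('a) \<and> CHAR('a) = 0) \<or>
       (\<exists>B::'a set. center_basis B \<and> CHAR('a) > 0 \<and>
          (\<exists>m. m ^ 2 = card B \<and> \<not> CHAR('a) dvd m) \<and> \<not> CHAR('a) dvd CARD('n))"
  shows "(UNIV :: ('a^'n^'n) set) =
           {Z + S | Z S. Z \<in> mat_center \<and>
              S \<in> span_F {mpeval p (A ** B) - mpeval p (B ** A) | A B :: 'a^'n^'n. True}}"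
proof -
  define k where "k = degree p"
  have k: "k > 0" using p_nonconst by (simp add: k_def)
  define V where "V = span_F {mpeval p (A ** B) - mpeval p (B ** A) | A B :: 'a^'n^'n. True}"
  have V: "M.subspace V" unfolding V_def by (rule subspace_span_F)
  have diff: "matpow (A ** B) k - matpow (B ** A) k \<in> V" for A B
    unfolding V_def k_def by (rule matpow_diff_in_span[OF inf_center p_central p_nonconst])
  have deg: "\<exists>d c. minimal_relation a d c \<and> of_nat d \<noteq> (0::'a)" for a :: 'a
    by (rule ex_minimal_relation_nonzero_degree) (use cases in blast)
  have n: "of_nat (CARD('n)) \<noteq> (0::'a)"
    using cases by (auto simp: of_nat_eq_0_iff_char_dvd)
  obtain i :: 'n where True by simp
  define V' where "V' = {x. munit i i x \<in> V}"
  have V': "D.subspace V'" unfolding V'_def by (rule subspace_munit[OF V])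
  have "(a * b) ^ k - (b * a) ^ k \<in> V'" for a b
    using diff[of "munit i i a" "munit i i b"]
    by (simp add: V'_def munit_mult matpow_munit k munit_diff)
  hence comm: "x * y - y * x \<in> V'" for x y
    by (rule subspace_contains_commutators[OF inf_center deg V' k])
  have "X \<in> {Z + S | Z S. Z \<in> mat_center \<and> S \<in> V}" for X :: "'a^'n^'n"
  proof -
    define t where "t = (\<Sum>j\<in>UNIV. X $ j $ j)"
    obtain d c where "minimal_relation t d c" and d: "of_nat d \<noteq> (0::'a)" using deg by blast
    then obtain z where z: "z \<in> center" "of_nat d * t - z \<in> V'"
      using minimal_relation.mod_commutators[of t d c V'] comm D.subspace_add[OF V'] D.subspace_0[OF V']
      by blast
    \<comment> \<open>\<open>c\<close> is chosen so that \<open>of_nat d\<close> times the trace of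
      the scalar matrix is \<open>z\<close>; subtracting that matrix turns
      \<open>of_nat d * t\<close> into \<open>of_nat d * t - z\<close>.\<close>
    define c where "c = inverse (of_nat CARD('n)) * (inverse (of_nat d) * z)"
    have c: "c \<in> center" unfolding c_def
      by (intro center_mult center_inverse center_of_nat z)
    have "of_nat d * (t - of_nat CARD('n) * c) = of_nat d * t - z"
      using n d by (simp add: c_def right_diff_distrib mult.assoc[symmetric])
    with z(2) have "t - of_nat CARD('n) * c \<in> V'"
      using subspace_cancel_center[OF V' center_of_nat d] by simp
    moreover have "(\<Sum>j\<in>UNIV. (X - mscale c (mat 1)) $ j $ j) = t - of_nat CARD('n) * c"
      by (simp add: mscale_def mat_def sum_subtractf t_def)
    ultimately have tr: "munit i i (\<Sum>j\<in>UNIV. (X - mscale c (mat 1)) $ j $ j) \<in> V"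
      by (simp only: V'_def mem_Collect_eq)
    have "X - mscale c (mat 1) \<in> V"
      by (rule subspace_contains_traceless[OF V k diff tr])
    moreover have "mscale c (mat 1) \<in> (mat_center :: ('a^'n^'n) set)"
      by (simp add: mat_center_def matrix_mscale_left matrix_mscale_right[OF c])
    ultimately show ?thesis
      by (intro CollectI exI[of _ "mscale c (mat 1)"] exI[of _ "X - mscale c (mat 1)"]) simp
  qed
  thus ?thesis unfolding V_def by blast
qed

end
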